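(* Let $\mathcal{L}$ be a finite relational language. If $U$ is a countable ultraextensive $\mathcal{L}$-structure, then the automorphism group $\mathrm{Aut}(U)$ has a dense locally finite subgroup.
   Context: $\mathrm{Aut}(U)$ carries the topology of pointwise convergence on the discrete set $U$. A group is locally finite if each of its finitely generated subgroups is finite. Basic notions. Substructures are induced substructures; $D$ is an extension of $C$ if $C$ is a substructure of $D$. HL-extensions. A partial isomorphism of an $\mathcal{L}$-structure $C$ is an isomorphism between two finite substructures of $C$. $\mathcal{P}_C$ denotes the set of partial isomorphisms $p$ of $C$ that are not restrictions of the identity map $1_C$. If $C_1\subseteq C_2$ then $\mathcal{P}_{C_1}\subseteq\mathcal{P}_{C_2}$. An HL-extension of $C$ is a pair $(D,\phi)$ where $D$ is an extension of $C$ and $\phi:\mathcal{P}_C\to\mathrm{Aut}(D)$ is such that $\phi(p)$ extends $p$ for all $p\in\mathcal{P}_C$; it is assumed throughout that $\phi(p^{-1})=\phi(p)^{-1}$. It is finite if $D$ is finite. It is minimal if for every $b\in D\setminus C$ there are $p_1,\dots,p_n\in\mathcal{P}_C$ and $a\in C$ with $b=\phi(p_1)\cdots\phi(p_n)(a)$. Coherence. Let $C_1\subseteq C_2$ and let $(D_i,\phi_i)$ be an HL-extension of $C_i$, $i=1,2$. They are coherent if (i) $D_2$ extends $D_1$; (ii) $\phi_2(p)$ extends $\phi_1(p)$ for all $p\in\mathcal{P}_{C_1}$; (iii) with $K_i=\langle\phi_i(\mathcal{P}_{C_i})\rangle\le\mathrm{Aut}(D_i)$, the map $\phi_1(p)\mapsto\phi_2(p)$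 ($p\in\mathcal{P}_{C_1}$) has a unique extension to an injective group homomorphism $K_1\to K_2$. Ultraextensive. An $\mathcal{L}$-structure $U$ is ultraextensive if (i) $U$ is ultrahomogeneous, i.e. there is $\phi$ such that $(U,\phi)$ is an HL-extension of $U$; (ii) every finite substructure $C\subseteq U$ has a finite HL-extension $(D,\phi)$ with $D\subseteq U$; (iii) if $C_1\subseteq C_2\subseteq U$ are finite and $(D_1,\phi_1)$ is a finite minimal HL-extension of $C_1$ with $D_1\subseteq U$, then there is a finite minimal HL-extension $(D_2,\phi_2)$ of $C_2$ with $D_2\subseteq U$ such that $(D_1,\phi_1)$ and $(D_2,\phi_2)$ are coherent. *)

theory Defs
  imports "HOL-Algebra.Bij" "HOL-Algebra.Generated_Groups" "HOL-Analysis.Function_Topology"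
begin

section \<open>Relational structures\<close>

text \<open>The values of \<open>arity\<close> and \<open>interp\<close> at names outside \<open>symbols\<close> are irrelevant.\<close>

record 'r language =
  symbols :: "'r set"
  arity :: "'r \<Rightarrow> nat"

record ('a, 'r) rel_structure =
  universe :: "'a set"
  interp :: "'r \<Rightarrow> 'a list set"

definition is_structure :: "'r language \<Rightarrow> ('a, 'r) rel_structure \<Rightarrow> bool" where
  "is_structure L M \<longleftrightarrow>
     (\<forall>R\<in>symbols L. interp M R \<subseteq> {xs. set xs \<subseteq> universe M \<and> length xs = arity L R})"

definition substructure ::
    "'r language \<Rightarrow> ('a, 'r) rel_structure \<Rightarrow> ('a, 'r) rel_structure \<Rightarrow> bool" where
  "substructure L C D \<longleftrightarrow>
     is_structure L C \<and> is_structure L D \<and> universe C \<subseteq> universe D \<and>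
     (\<forall>R\<in>symbols L. interp C R = {xs \<in> interp D R. set xs \<subseteq> universe C})"

definition finite_structure :: "('a, 'r) rel_structure \<Rightarrow> bool" where
  "finite_structure M \<longleftrightarrow> finite (universe M)"

definition isomorphism ::
    "'r language \<Rightarrow> ('a, 'r) rel_structure \<Rightarrow> ('a, 'r) rel_structure \<Rightarrow> ('a \<Rightarrow> 'a) \<Rightarrow> bool" where
  "isomorphism L A B f \<longleftrightarrow>
     bij_betw f (universe A) (universe B) \<and>
     (\<forall>R\<in>symbols L. \<forall>xs. set xs \<subseteq> universe A \<and> length xs = arity L R \<longrightarrow>
        (xs \<in> interp A R \<longleftrightarrow> map f xs \<in> interp B R))"

definition Aut :: "'r language \<Rightarrow> ('a, 'r) rel_structure \<Rightarrow> ('a \<Rightarrow> 'a) monoid" where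
  "Aut L M =
     (BijGroup (universe M)) \<lparr>carrier := {f \<in> Bij (universe M). isomorphism L M M f}\<rparr>"

text \<open>Elements of \<open>Aut L M\<close> are extensional on \<open>universe M\<close>, hence points of the product
  of copies of the discrete space \<open>universe M\<close>.\<close>

definition Aut_topology :: "'r language \<Rightarrow> ('a, 'r) rel_structure \<Rightarrow> ('a \<Rightarrow> 'a) topology" where
  "Aut_topology L M =
     subtopology (product_topology (\<lambda>_. discrete_topology (universe M)) (universe M))
       (carrier (Aut L M))"

definition locally_finite_group :: "('g, 'm) monoid_scheme \<Rightarrow> bool" where
  "locally_finite_group G \<longleftrightarrow>
     group G \<and> (\<forall>S. S \<subseteq> carrier G \<and> finite S \<longrightarrow> finite (generate G S))"


section \<open>HL-extensions\<close>

text \<open>A partial isomorphism is represented by its graph, so that its inverse is the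
  converse relation and restriction is inclusion of relations.\<close>

definition partial_isos :: "'r language \<Rightarrow> ('a, 'r) rel_structure \<Rightarrow> 'a rel set" where
  "partial_isos L C =
     {p. \<exists>A B f. substructure L A C \<and> finite_structure A \<and>
                 substructure L B C \<and> finite_structure B \<and>
                 isomorphism L A B f \<and> p = (\<lambda>x. (x, f x)) ` universe A}"

definition PP :: "'r language \<Rightarrow> ('a, 'r) rel_structure \<Rightarrow> 'a rel set" where
  "PP L C = {p \<in> partial_isos L C. \<not> p \<subseteq> Id_on (universe C)}"

text \<open>Only the values of \<open>\<phi>\<close> on \<open>PP L C\<close> are meaningful.\<close>

definition HL_extension ::
    "'r language \<Rightarrow> ('a, 'r) rel_structure \<Rightarrow> ('a, 'r) rel_structure
       \<Rightarrow> ('a rel \<Rightarrow> 'a \<Rightarrow> 'a) \<Rightarrow> bool" where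
  "HL_extension L C D \<phi> \<longleftrightarrow>
     substructure L C D \<and>
     \<phi> \<in> PP L C \<rightarrow> carrier (Aut L D) \<and>
     (\<forall>p\<in>PP L C. \<forall>(x, y)\<in>p. \<phi> p x = y) \<and>
     (\<forall>p\<in>PP L C. \<phi> (p\<inverse>) = inv\<^bsub>Aut L D\<^esub> (\<phi> p))"

text \<open>\<open>foldr \<phi> [p\<^sub>1, \<dots>, p\<^sub>n] a\<close> is \<open>\<phi> p\<^sub>1 (\<dots> (\<phi> p\<^sub>n a))\<close>.\<close>

definition minimal_HL_extension ::
    "'r language \<Rightarrow> ('a, 'r) rel_structure \<Rightarrow> ('a, 'r) rel_structure
       \<Rightarrow> ('a rel \<Rightarrow> 'a \<Rightarrow> 'a) \<Rightarrow> bool" where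
  "minimal_HL_extension L C D \<phi> \<longleftrightarrow>
     HL_extension L C D \<phi> \<and>
     (\<forall>b \<in> universe D - universe C.
        \<exists>ps a. ps \<noteq> [] \<and> set ps \<subseteq> PP L C \<and> a \<in> universe C \<and> b = foldr \<phi> ps a)"

definition HL_group ::
    "'r language \<Rightarrow> ('a, 'r) rel_structure \<Rightarrow> ('a, 'r) rel_structure
       \<Rightarrow> ('a rel \<Rightarrow> 'a \<Rightarrow> 'a) \<Rightarrow> ('a \<Rightarrow> 'a) monoid" where
  "HL_group L C D \<phi> = (Aut L D) \<lparr>carrier := generate (Aut L D) (\<phi> ` PP L C)\<rparr>"

text \<open>Extensionality of \<open>h\<close> makes \<open>\<exists>!\<close> express uniqueness of a map defined on the group only.\<close>

definition coherent ::
    "'r language \<Rightarrow>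
     ('a, 'r) rel_structure \<Rightarrow> ('a, 'r) rel_structure \<Rightarrow> ('a rel \<Rightarrow> 'a \<Rightarrow> 'a) \<Rightarrow>
     ('a, 'r) rel_structure \<Rightarrow> ('a, 'r) rel_structure \<Rightarrow> ('a rel \<Rightarrow> 'a \<Rightarrow> 'a) \<Rightarrow> bool" where
  "coherent L C1 D1 \<phi>1 C2 D2 \<phi>2 \<longleftrightarrow>
     substructure L C1 C2 \<and> HL_extension L C1 D1 \<phi>1 \<and> HL_extension L C2 D2 \<phi>2 \<and>
     substructure L D1 D2 \<and>
     (\<forall>p\<in>PP L C1. \<forall>x\<in>universe D1. \<phi>2 p x = \<phi>1 p x) \<and>
     (\<exists>!h. h \<in> extensional (carrier (HL_group L C1 D1 \<phi>1)) \<and>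
           h \<in> mon (HL_group L C1 D1 \<phi>1) (HL_group L C2 D2 \<phi>2) \<and>
           (\<forall>p\<in>PP L C1. h (\<phi>1 p) = \<phi>2 p))"


section \<open>Ultraextensive structures\<close>

definition ultrahomogeneous :: "'r language \<Rightarrow> ('a, 'r) rel_structure \<Rightarrow> bool" where
  "ultrahomogeneous L U \<longleftrightarrow> (\<exists>\<phi>. HL_extension L U U \<phi>)"

definition ultraextensive :: "'r language \<Rightarrow> ('a, 'r) rel_structure \<Rightarrow> bool" where
  "ultraextensive L U \<longleftrightarrow>
     ultrahomogeneous L U \<and>
     (\<forall>C. substructure L C U \<and> finite_structure C \<longrightarrow>
        (\<exists>D \<phi>. substructure L D U \<and> finite_structure D \<and> HL_extension L C D \<phi>)) \<and>
     (\<forall>C1 C2 D1 \<phi>1.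
        substructure L C1 C2 \<and> substructure L C2 U \<and>
        finite_structure C1 \<and> finite_structure C2 \<and>
        substructure L D1 U \<and> finite_structure D1 \<and> minimal_HL_extension L C1 D1 \<phi>1 \<longrightarrow>
        (\<exists>D2 \<phi>2. substructure L D2 U \<and> finite_structure D2 \<and>
                  minimal_HL_extension L C2 D2 \<phi>2 \<and> coherent L C1 D1 \<phi>1 C2 D2 \<phi>2))"

end

theory Submission
  imports Defs
begin

text \<open>Exhaust \<open>U\<close> by a chain of finite structures \<open>C 0 \<subseteq> D 0 \<subseteq> C 1 \<subseteq> D 1 \<subseteq> \<dots>\<close>, where
  \<open>(D n, \<phi> n)\<close> is a minimal HL-extension of \<open>C n\<close> and consecutive ones are coherent.
  The maps \<open>\<phi> n p\<close> of a partial isomorphism \<open>p\<close> increase to an automorphism of \<open>U\<close> extending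
  \<open>p\<close>, so that the words in these automorphisms form a dense set. By coherence a word
  over \<open>PP L (C n)\<close> is determined by its action on the finite set \<open>D n\<close>; hence these words form a
  finite group, and the dense subgroup is the increasing union of these finite groups.\<close>

section \<open>Automorphism groups\<close>

lemma carrier_Aut: "carrier (Aut L M) = {f \<in> Bij (universe M). isomorphism L M M f}"
  by (simp add: Aut_def)

lemma subgroup_isomorphisms:
  "subgroup {f \<in> Bij (universe M). isomorphism L M M f} (BijGroup (universe M))"
    (is "subgroup ?A ?G")
proof (rule group.subgroupI)
  let ?S = "universe M"
  show "group ?G" by (rule group_BijGroup)
  show "?A \<subseteq> carrier ?G" by (auto simp: BijGroup_def)
  have "(\<lambda>x\<in>?S. x) \<in> ?A"
  proof -
    have "map (\<lambda>x\<in>?S. x) xs = xs" if "set xs \<subseteq> ?S" for xs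
      using that by (induction xs) auto
    then show ?thesis
      using id_Bij[of ?S] by (simp add: isomorphism_def) (simp add: Bij_def)
  qed
  then show "?A \<noteq> {}" by blast
next
  let ?S = "universe M"
  fix f assume f: "f \<in> ?A"
  then have fB: "f \<in> Bij ?S" and iso: "isomorphism L M M f" by auto
  then have bij: "bij_betw f ?S ?S" by (simp add: isomorphism_def)
  define g where "g = (\<lambda>x\<in>?S. inv_into ?S f x)"
  have inv: "inv\<^bsub>?G\<^esub> f = g" using fB by (simp add: inv_BijGroup g_def)
  have gB: "g \<in> Bij ?S" unfolding g_def using fB by (rule restrict_inv_into_Bij)
  have "xs \<in> interp M R \<longleftrightarrow> map g xs \<in> interp M R"
    if "R \<in> symbols L" "set xs \<subseteq> ?S" "length xs = arity L R" for R xs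
  proof -
    \<comment> \<open>Since \<open>f\<close> undoes \<open>g\<close> on \<open>?S\<close>,
      preservation by \<open>g\<close> at \<open>xs\<close> is preservation by \<open>f\<close> read
      backwards at the tuple \<open>map g xs\<close>.\<close>
    have gS: "g x \<in> ?S" "f (g x) = x" if "x \<in> ?S" for x
      using bij that unfolding g_def
      by (auto simp: bij_betw_def f_inv_into_f inv_into_into)
    have "map f (map g xs) = xs" "set (map g xs) \<subseteq> ?S"
      using that(2) gS by (auto intro!: map_idI)
    then show ?thesis using iso that unfolding isomorphism_def
      by (metis length_map)
  qed
  then show "inv\<^bsub>?G\<^esub> f \<in> ?A"
    using gB by (simp add: inv isomorphism_def) (simp add: Bij_def)
next
  let ?S = "universe M"
  fix f g assume fg: "f \<in> ?A" "g \<in> ?A"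
  then have B: "compose ?S f g \<in> Bij ?S" by (auto intro: compose_Bij)
  have "xs \<in> interp M R \<longleftrightarrow> map (compose ?S f g) xs \<in> interp M R"
    if "R \<in> symbols L" "set xs \<subseteq> ?S" "length xs = arity L R" for R xs
  proof -
    have "map (compose ?S f g) xs = map f (map g xs)"
      using that(2) by (auto simp: compose_eq)
    moreover have "g ` ?S \<subseteq> ?S" using fg by (simp add: isomorphism_def bij_betw_def)
    then have "set (map g xs) \<subseteq> ?S" using that(2) by auto
    ultimately show ?thesis
      using fg that unfolding isomorphism_def mem_Collect_eq by (metis length_map)
  qed
  then show "f \<otimes>\<^bsub>?G\<^esub> g \<in> ?A"
    using fg B by (simp add: BijGroup_def isomorphism_def) (simp add: Bij_def)
qed

lemma group_Aut: "group (Aut L M)"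
  unfolding Aut_def
  by (rule subgroup.subgroup_is_group[OF subgroup_isomorphisms group_BijGroup])

lemma mult_Aut:
  "\<lbrakk>f \<in> carrier (Aut L M); g \<in> carrier (Aut L M)\<rbrakk> \<Longrightarrow> f \<otimes>\<^bsub>Aut L M\<^esub> g = compose (universe M) f g"
  by (simp add: carrier_Aut) (simp add: Aut_def BijGroup_def)

lemma one_Aut: "\<one>\<^bsub>Aut L M\<^esub> = (\<lambda>x\<in>universe M. x)"
  by (simp add: Aut_def BijGroup_def)

lemma Aut_extensional: "f \<in> carrier (Aut L M) \<Longrightarrow> f \<in> extensional (universe M)"
  by (simp add: carrier_Aut Bij_def)

lemma Aut_bij: "f \<in> carrier (Aut L M) \<Longrightarrow> bij_betw f (universe M) (universe M)"
  by (simp add: carrier_Aut Bij_def)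

lemma Aut_closed: "\<lbrakk>f \<in> carrier (Aut L M); x \<in> universe M\<rbrakk> \<Longrightarrow> f x \<in> universe M"
  using Aut_bij by (fastforce simp: bij_betw_def)

text \<open>Left multiplication by an element \<open>a\<close> of \<open>W\<close> is injective on
  the finite set \<open>W\<close>, hence onto, so the unit is a product \<open>a \<otimes> y\<close>
  with \<open>y\<close> in \<open>W\<close>. This gives groups of words without computing the
  inverse of a word.\<close>

lemma (in group) finite_submonoid_subgroup:
  assumes "finite W" "W \<subseteq> carrier G" "\<one> \<in> W" "\<And>x y. \<lbrakk>x \<in> W; y \<in> W\<rbrakk> \<Longrightarrow> x \<otimes> y \<in> W"
  shows "subgroup W G"
proof (rule subgroupI)
  fix a assume a: "a \<in> W"
  have "inj_on (\<lambda>y. a \<otimes> y) W"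
    using a assms(2) by (auto simp: inj_on_def subset_iff)
  then have "(\<lambda>y. a \<otimes> y) ` W = W"
    using assms a by (intro endo_inj_surj) auto
  then obtain y where "y \<in> W" "a \<otimes> y = \<one>"
    using assms(3) by (metis (no_types, lifting) imageE)
  then show "inv a \<in> W"
    using a assms(2) by (metis inv_unique' inv_comm subsetD)
qed (use assms(2-4) in blast)+


section \<open>Substructures and partial isomorphisms\<close>

definition induced :: "('a, 'r) rel_structure \<Rightarrow> 'a set \<Rightarrow> ('a, 'r) rel_structure" where
  "induced M A = \<lparr>universe = A, interp = \<lambda>R. {xs \<in> interp M R. set xs \<subseteq> A}\<rparr>"

lemma universe_induced [simp]: "universe (induced M A) = A"
  by (simp add: induced_def)

lemma substructure_induced:
  "\<lbrakk>is_structure L M; A \<subseteq> universe M\<rbrakk> \<Longrightarrow> substructure L (induced M A) M"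
  unfolding substructure_def is_structure_def induced_def by auto

lemma substructure_trans: "\<lbrakk>substructure L A B; substructure L B C\<rbrakk> \<Longrightarrow> substructure L A C"
  unfolding substructure_def by auto

lemma substructure_within:
  "\<lbrakk>substructure L A M; substructure L B M; universe A \<subseteq> universe B\<rbrakk> \<Longrightarrow> substructure L A B"
  unfolding substructure_def by auto

lemma PP_mono:
  assumes "substructure L A B"
  shows "PP L A \<subseteq> PP L B"
proof
  fix p assume p: "p \<in> PP L A"
  then obtain X Y f where *: "substructure L X A" "finite_structure X" "substructure L Y A"
    "finite_structure Y" "isomorphism L X Y f" "p = (\<lambda>x. (x, f x)) ` universe X"
    by (auto simp: PP_def partial_isos_def)
  then have "substructure L X B" "substructure L Y B"
    using assms substructure_trans by blast+
  then have "p \<in> partial_isos L B" using * unfolding partial_isos_def by blast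
  \<comment> \<open>The domain of \<open>p\<close> lies in \<open>A\<close>, so \<open>p\<close> is
    outside the identity of \<open>A\<close> only if it moves a point, and a moved point stays moved
    in \<open>B\<close>.\<close>
  moreover have "universe X \<subseteq> universe A" using * by (simp add: substructure_def)
  then have "\<not> p \<subseteq> Id_on (universe B)"
    using p *(6) unfolding PP_def Id_on_def by auto
  ultimately show "p \<in> PP L B" by (simp add: PP_def)
qed

text \<open>Supplies the letters used for density: a finite piece of an automorphism of
  \<open>U\<close> is a partial isomorphism of \<open>C\<close> once \<open>C\<close> contains both
  its domain and its image. The moved point keeps it from being a restriction of the
  identity.\<close>

lemma Aut_restriction_PP:
  assumes "is_structure L U" "g \<in> carrier (Aut L U)" "substructure L C U"
    and "finite F" "F \<subseteq> universe C" "g ` F \<subseteq> universe C" "x \<in> F" "g x \<noteq> x"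
  shows "(\<lambda>x. (x, g x)) ` F \<in> PP L C"
proof -
  have CU: "universe C \<subseteq> universe U" using assms(3) by (simp add: substructure_def)
  have sub: "substructure L (induced U F) C" "substructure L (induced U (g ` F)) C"
    using assms CU by (auto intro!: substructure_within[OF substructure_induced])
  have bij: "bij_betw g (universe U) (universe U)" using assms(2) by (rule Aut_bij)
  have FU: "F \<subseteq> universe U" using assms CU by blast
  have "isomorphism L (induced U F) (induced U (g ` F)) g"
    unfolding isomorphism_def
  proof (intro conjI ballI allI impI)
    show "bij_betw g (universe (induced U F)) (universe (induced U (g ` F)))"
      using bij FU by (auto simp: bij_betw_def inj_on_def)
  next
    fix R xs
    assume "R \<in> symbols L" "set xs \<subseteq> universe (induced U F) \<and> length xs = arity L R"
    then show "xs \<in> interp (induced U F) R \<longleftrightarrow> map g xs \<in> interp (induced U (g ` F)) R"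
      using assms(2) FU by (auto simp: carrier_Aut isomorphism_def induced_def)
  qed
  moreover have "finite_structure (induced U F)" "finite_structure (induced U (g ` F))"
    using assms(4) by (auto simp: finite_structure_def)
  ultimately have "(\<lambda>x. (x, g x)) ` F \<in> partial_isos L C"
    using sub unfolding partial_isos_def mem_Collect_eq universe_induced
    by (metis universe_induced)
  then show ?thesis using assms(7,8) by (auto simp: PP_def)
qed


section \<open>The limit of a coherent chain\<close>

locale coherent_chain =
  fixes L :: "'r language" and U :: "('a, 'r) rel_structure"
    and C D :: "nat \<Rightarrow> ('a, 'r) rel_structure" and \<phi> :: "nat \<Rightarrow> 'a rel \<Rightarrow> 'a \<Rightarrow> 'a"
  assumes is_structure: "is_structure L U"
    and coherent: "\<And>n. coherent L (C n) (D n) (\<phi> n) (C (Suc n)) (D (Suc n)) (\<phi> (Suc n))"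
    and D_substructure: "\<And>n. substructure L (D n) U"
    and finite_D: "\<And>n. finite (universe (D n))"
    and exhaust: "universe U \<subseteq> (\<Union>n. universe (C n))"
begin

section \<open>Monotonicity and exhaustion along the chain\<close>

lemma HL: "HL_extension L (C n) (D n) (\<phi> n)"
  using coherent by (simp add: coherent_def)

lemma C_substructure_D: "substructure L (C n) (D n)"
  using HL by (simp add: HL_extension_def)

lemma C_substructure: "substructure L (C n) U"
  using C_substructure_D D_substructure substructure_trans by blast

lemma D_subset: "universe (D n) \<subseteq> universe U"
  using D_substructure by (simp add: substructure_def)

lemma C_subset_D: "universe (C n) \<subseteq> universe (D n)"
  using C_substructure_D by (simp add: substructure_def)

lemma phi_Aut: "p \<in> PP L (C n) \<Longrightarrow> \<phi> n p \<in> carrier (Aut L (D n))"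
  using HL[of n] by (auto simp: HL_extension_def)

lemma C_mono: "m \<le> n \<Longrightarrow> universe (C m) \<subseteq> universe (C n)"
  by (rule lift_Suc_mono_le[of "\<lambda>n. universe (C n)"])
    (use coherent in \<open>simp_all add: coherent_def substructure_def\<close>)

lemma D_mono: "m \<le> n \<Longrightarrow> universe (D m) \<subseteq> universe (D n)"
  by (rule lift_Suc_mono_le[of "\<lambda>n. universe (D n)"])
    (use coherent in \<open>simp_all add: coherent_def substructure_def\<close>)

lemma PP_chain: "m \<le> n \<Longrightarrow> PP L (C m) \<subseteq> PP L (C n)"
  by (rule lift_Suc_mono_le[of "\<lambda>n. PP L (C n)"])
    (use coherent in \<open>simp_all add: coherent_def PP_mono\<close>)

text \<open>Iterates clause (ii) of coherence. The maps \<open>\<phi> n p\<close> grow with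
  \<open>n\<close>, so they have a union.\<close>

lemma phi_chain:
  assumes "m \<le> n" "p \<in> PP L (C m)" "x \<in> universe (D m)"
  shows "\<phi> n p x = \<phi> m p x"
  using assms(1)
proof (induction n rule: dec_induct)
  case (step n)
  have "p \<in> PP L (C n)" "x \<in> universe (D n)"
    using PP_chain D_mono step assms by blast+
  then show ?case using coherent[of n] step.IH by (simp add: coherent_def)
qed simp

lemma finite_subset_C:
  assumes "finite F" "F \<subseteq> universe U"
  shows "\<exists>n\<ge>k. F \<subseteq> universe (C n)"
proof -
  \<comment> \<open>Containment at all late stages is the form that survives the induction and lets
    the index be pushed past \<open>k\<close>.\<close>
  have "\<exists>n. \<forall>m\<ge>n. F \<subseteq> universe (C m)"
    using assms
  proof (induction F)
    case (insert x F)
    then obtain m n where "\<forall>j\<ge>n. F \<subseteq> universe (C j)" "x \<in> universe (C m)"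
      using exhaust by blast
    then have "insert x F \<subseteq> universe (C j)" if "j \<ge> max m n" for j
      using C_mono[of m j] that by auto
    then show ?case by blast
  qed auto
  then obtain n where "\<forall>m\<ge>n. F \<subseteq> universe (C m)" ..
  then have "F \<subseteq> universe (C (max n k))" by simp
  then show ?thesis by (intro exI[of _ "max n k"]) simp
qed

lemma finite_subset_D: "\<lbrakk>finite F; F \<subseteq> universe U\<rbrakk> \<Longrightarrow> \<exists>n\<ge>k. F \<subseteq> universe (D n)"
  using finite_subset_C[of F k] C_subset_D by blast

section \<open>Limits of the finite-stage automorphisms\<close>

definition limit :: "'a rel \<Rightarrow> 'a \<Rightarrow> 'a" where
  "limit p x = \<phi> (LEAST n. p \<in> PP L (C n) \<and> x \<in> universe (D n)) p x"

text \<open>The least index in \<open>limit\<close> is an arbitrary choice: by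
  \<open>phi_chain\<close> every stage at which \<open>p\<close> and \<open>x\<close> are both
  present gives the same value.\<close>

lemma limit_eq:
  assumes "p \<in> PP L (C n)" "x \<in> universe (D n)"
  shows "limit p x = \<phi> n p x"
proof -
  let ?P = "\<lambda>n. p \<in> PP L (C n) \<and> x \<in> universe (D n)"
  have "?P (Least ?P)" "Least ?P \<le> n"
    using assms LeastI[of ?P n] Least_le[of ?P n] by auto
  then show ?thesis unfolding limit_def using phi_chain[of "Least ?P" n p x] by simp
qed

section \<open>Words in the limits and their action on the finite stages\<close>

definition word :: "'a rel list \<Rightarrow> 'a \<Rightarrow> 'a" where
  "word ps = restrict (foldr limit ps) (universe U)"

text \<open>There are no separate inverse letters, so a priori this is only the monoid generated by
  the limits at stage \<open>n\<close>. It becomes a group through its finiteness.\<close>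

definition words :: "nat \<Rightarrow> ('a \<Rightarrow> 'a) set" where
  "words n = word ` {ps. set ps \<subseteq> PP L (C n)}"

text \<open>Each limit of a letter of stage \<open>n\<close> maps \<open>D n\<close> to itself and
  acts there as \<open>\<phi> n\<close>. The second conjunct is what carries the induction from one
  letter to the next.\<close>

lemma foldr_limit:
  assumes "set ps \<subseteq> PP L (C n)" "x \<in> universe (D n)"
  shows "foldr limit ps x = foldr (\<phi> n) ps x \<and> foldr (\<phi> n) ps x \<in> universe (D n)"
  using assms(1)
proof (induction ps)
  case (Cons p ps)
  then have p: "p \<in> PP L (C n)"
    and IH: "foldr limit ps x = foldr (\<phi> n) ps x" "foldr (\<phi> n) ps x \<in> universe (D n)"
    by auto
  then show ?case using limit_eq[OF p IH(2)] Aut_closed[OF phi_Aut[OF p] IH(2)] by simp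
qed (use assms in simp)

text \<open>Each requirement on an automorphism involves finitely many points: two for injectivity,
  one for surjectivity, the entries of a tuple for a relation. It can be checked in a single
  \<open>D m\<close>, where \<open>\<phi> m p\<close> is an automorphism and the relations are those
  induced from \<open>U\<close>.\<close>

lemma limit_Aut:
  assumes p: "p \<in> PP L (C n)"
  shows "restrict (limit p) (universe U) \<in> carrier (Aut L U)"
proof -
  \<comment> \<open>Searching only beyond \<open>n\<close> ensures that \<open>p\<close> is a letter
    at the stage found.\<close>
  have pm: "\<exists>m\<ge>n. F \<subseteq> universe (D m) \<and> p \<in> PP L (C m)"
    if "finite F" "F \<subseteq> universe U" for F
    using finite_subset_D[OF that, of n] p PP_chain by blast
  have lim: "limit p x = \<phi> m p x" if "p \<in> PP L (C m)" "x \<in> universe (D m)" for m x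
    using that by (rule limit_eq)
  have bijm: "bij_betw (\<phi> m p) (universe (D m)) (universe (D m))" if "p \<in> PP L (C m)" for m
    by (rule Aut_bij[OF phi_Aut[OF that]])
  have "inj_on (limit p) (universe U)"
  proof (rule inj_onI)
    fix x y assume *: "x \<in> universe U" "y \<in> universe U" "limit p x = limit p y"
    obtain m where m: "{x, y} \<subseteq> universe (D m)" "p \<in> PP L (C m)"
      using pm[of "{x, y}"] * by auto
    then show "x = y" using * bijm[of m] lim[of m] by (auto simp: bij_betw_def inj_on_def)
  qed
  moreover have "limit p ` universe U = universe U"
  proof
    show "limit p ` universe U \<subseteq> universe U"
    proof
      fix y assume "y \<in> limit p ` universe U"
      then obtain x where x: "x \<in> universe U" "y = limit p x" by blast
      obtain m where "{x} \<subseteq> universe (D m)" "p \<in> PP L (C m)" using pm[of "{x}"] x by auto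
      then show "y \<in> universe U"
        using x lim[of m x] bijm[of m] D_subset[of m] by (auto simp: bij_betw_def)
    qed
    show "universe U \<subseteq> limit p ` universe U"
    proof
      fix y assume y: "y \<in> universe U"
      obtain m where m: "{y} \<subseteq> universe (D m)" "p \<in> PP L (C m)" using pm[of "{y}"] y by auto
      then obtain x where "x \<in> universe (D m)" "\<phi> m p x = y"
        using bij_betw_imp_surj_on[OF bijm[OF m(2)]] by (metis imageE insert_subset)
      then show "y \<in> limit p ` universe U"
        using lim[of m x] m D_subset[of m] by force
    qed
  qed
  ultimately have bij: "bij_betw (restrict (limit p) (universe U)) (universe U) (universe U)"
    by (simp add: bij_betw_def)
  have "xs \<in> interp U R \<longleftrightarrow> map (restrict (limit p) (universe U)) xs \<in> interp U R"
    if R: "R \<in> symbols L" and xs: "set xs \<subseteq> universe U" "length xs = arity L R" for R xs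
  proof -
    obtain m where m: "set xs \<subseteq> universe (D m)" "p \<in> PP L (C m)"
      using pm[of "set xs"] xs by auto
    have eq: "map (restrict (limit p) (universe U)) xs = map (\<phi> m p) xs"
      using m xs lim by auto
    have "interp (D m) R = {ys \<in> interp U R. set ys \<subseteq> universe (D m)}"
      using D_substructure[of m] R by (simp add: substructure_def)
    moreover have "set (map (\<phi> m p) xs) \<subseteq> universe (D m)"
      using m bijm[of m] by (auto simp: bij_betw_def)
    moreover have "xs \<in> interp (D m) R \<longleftrightarrow> map (\<phi> m p) xs \<in> interp (D m) R"
      using phi_Aut[OF m(2)] m(1) R xs(2) by (auto simp: carrier_Aut isomorphism_def)
    ultimately show ?thesis using m(1) unfolding eq by auto
  qed
  then show ?thesis using bij by (simp add: carrier_Aut Bij_def isomorphism_def)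
qed

lemma word_Nil: "word [] = \<one>\<^bsub>Aut L U\<^esub>"
  by (auto simp: word_def one_Aut)

lemma word_Aut: "set ps \<subseteq> PP L (C n) \<Longrightarrow> word ps \<in> carrier (Aut L U)"
proof (induction ps)
  case Nil
  show ?case unfolding word_Nil by (intro monoid.one_closed group.is_monoid group_Aut)
next
  case (Cons p ps)
  have "word (p # ps) = compose (universe U) (restrict (limit p) (universe U)) (word ps)"
    using Aut_closed[of "word ps"] Cons
    by (fastforce simp: word_def compose_def)
  also have "\<dots> = restrict (limit p) (universe U) \<otimes>\<^bsub>Aut L U\<^esub> word ps"
    using Cons limit_Aut by (subst mult_Aut) auto
  finally show ?case using Cons limit_Aut
    by (auto intro!: monoid.m_closed[OF group.is_monoid[OF group_Aut]])
qed

lemma word_append: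
  assumes "set ps \<subseteq> PP L (C n)" "set qs \<subseteq> PP L (C n)"
  shows "word ps \<otimes>\<^bsub>Aut L U\<^esub> word qs = word (ps @ qs)"
proof -
  have "word ps \<otimes>\<^bsub>Aut L U\<^esub> word qs = compose (universe U) (word ps) (word qs)"
    using assms word_Aut by (intro mult_Aut) auto
  also have "\<dots> = word (ps @ qs)"
    using Aut_closed[OF word_Aut[OF assms(2)]] by (fastforce simp: word_def compose_def)
  finally show ?thesis .
qed

text \<open>The homomorphism provided by coherence maps the word \<open>ps\<close> evaluated in \<open>D n\<close> to the same
  word evaluated in \<open>D (Suc n)\<close>.\<close>

lemma word_action_Suc:
  assumes ps: "set ps \<subseteq> PP L (C n)" and qs: "set qs \<subseteq> PP L (C n)"
    and eq: "\<And>x. x \<in> universe (D n) \<Longrightarrow> foldr (\<phi> n) ps x = foldr (\<phi> n) qs x"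
    and x: "x \<in> universe (D (Suc n))"
  shows "foldr (\<phi> (Suc n)) ps x = foldr (\<phi> (Suc n)) qs x"
proof -
  let ?K = "HL_group L (C n) (D n) (\<phi> n)"
  let ?K' = "HL_group L (C (Suc n)) (D (Suc n)) (\<phi> (Suc n))"
  \<comment> \<open>The word \<open>rs\<close> evaluated at stage \<open>k\<close>; the restriction
    makes it extensional, hence an actual element of the group acting on \<open>D k\<close>.\<close>
  define e where "e k rs = restrict (foldr (\<phi> k) rs) (universe (D k))" for k rs
  obtain h where h: "h \<in> mon ?K ?K'"
    and h_phi: "\<And>p. p \<in> PP L (C n) \<Longrightarrow> h (\<phi> n p) = \<phi> (Suc n) p"
    using coherent[of n] unfolding coherent_def by blast
  have hom: "h \<in> hom ?K ?K'" using h by (simp add: mon_def)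
  have sub: "subgroup (generate (Aut L (D k)) (\<phi> k ` PP L (C k))) (Aut L (D k))" for k
    using phi_Aut by (intro group.generate_is_subgroup group_Aut) auto
  have grp: "group (HL_group L (C k) (D k) (\<phi> k))" for k
    unfolding HL_group_def by (rule subgroup.subgroup_is_group[OF sub group_Aut])
  have gen: "\<phi> n p \<in> carrier ?K" if "p \<in> PP L (C n)" for p
    using that by (auto simp: HL_group_def intro: generate.incl)
  have e_Nil: "e k [] = \<one>\<^bsub>HL_group L (C k) (D k) (\<phi> k)\<^esub>" for k
    using one_Aut[of L "D k"] by (auto simp: e_def HL_group_def)
  have K_Aut: "carrier (HL_group L (C k) (D k) (\<phi> k)) \<subseteq> carrier (Aut L (D k))" for k
    using subgroup.subset[OF sub] by (simp add: HL_group_def)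
  have e_Cons: "e k (r # rs) = \<phi> k r \<otimes>\<^bsub>HL_group L (C k) (D k) (\<phi> k)\<^esub> e k rs"
    if "r \<in> PP L (C k)" "e k rs \<in> carrier (HL_group L (C k) (D k) (\<phi> k))" for k r rs
  proof -
    have "\<phi> k r \<otimes>\<^bsub>HL_group L (C k) (D k) (\<phi> k)\<^esub> e k rs = compose (universe (D k)) (\<phi> k r) (e k rs)"
      using that K_Aut[of k] phi_Aut mult_Aut[of "\<phi> k r" L "D k" "e k rs"]
      by (auto simp: HL_group_def)
    then show ?thesis by (auto simp: e_def compose_def)
  qed
  \<comment> \<open>Membership is proved together with the equation because \<open>h\<close> is
    multiplicative only on the carrier.\<close>
  have h_e: "e n rs \<in> carrier ?K \<and> h (e n rs) = e (Suc n) rs" if "set rs \<subseteq> PP L (C n)" for rs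
    using that
  proof (induction rs)
    case Nil
    then show ?case using e_Nil grp hom group.is_monoid[OF grp] hom_one[OF hom grp grp]
      by (simp add: monoid.one_closed)
  next
    case (Cons r rs)
    then have r: "r \<in> PP L (C n)" "r \<in> PP L (C (Suc n))" using PP_chain[of n "Suc n"] by auto
    have IH: "e n rs \<in> carrier ?K" "h (e n rs) = e (Suc n) rs" using Cons by auto
    then have "e (Suc n) rs \<in> carrier ?K'" using hom_in_carrier[OF hom] by metis
    then show ?case
      using e_Cons r IH gen h_phi hom_mult[OF hom] monoid.m_closed[OF group.is_monoid[OF grp]]
      by simp
  qed
  \<comment> \<open>Words that agree on \<open>D n\<close> are one and the same group element, so
    \<open>h\<close> gives them one image.\<close>
  have "e n ps = e n qs" using eq by (auto simp: e_def)
  then have "e (Suc n) ps = e (Suc n) qs" using h_e ps qs by metis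
  then show ?thesis using x by (metis e_def restrict_apply')
qed

lemma word_action:
  assumes "n \<le> m" "set ps \<subseteq> PP L (C n)" "set qs \<subseteq> PP L (C n)"
    and "\<And>x. x \<in> universe (D n) \<Longrightarrow> foldr (\<phi> n) ps x = foldr (\<phi> n) qs x"
  shows "\<forall>x\<in>universe (D m). foldr (\<phi> m) ps x = foldr (\<phi> m) qs x"
  using assms(1)
proof (induction m rule: dec_induct)
  case (step m)
  then show ?case using word_action_Suc[of ps m qs] PP_chain[of n m] assms by blast
qed (use assms in auto)

text \<open>Restriction to \<open>D n\<close> sends \<open>words n\<close> into the finite set of
  self-maps of \<open>D n\<close>. It loses nothing: by coherence, agreement of two words on
  \<open>D n\<close> spreads to all later \<open>D m\<close>, and these cover
  \<open>U\<close>.\<close>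

lemma finite_words: "finite (words n)"
proof (rule inj_on_finite)
  let ?r = "\<lambda>w. restrict w (universe (D n))"
  show "inj_on ?r (words n)"
  proof (rule inj_onI)
    fix v w assume "v \<in> words n" "w \<in> words n" and eq: "?r v = ?r w"
    then obtain ps qs where ps: "set ps \<subseteq> PP L (C n)" "v = word ps"
      and qs: "set qs \<subseteq> PP L (C n)" "w = word qs"
      by (auto simp: words_def)
    have agree: "foldr (\<phi> n) ps x = foldr (\<phi> n) qs x" if "x \<in> universe (D n)" for x
    proof -
      have "v x = w x" using eq that by (metis restrict_apply')
      moreover have "x \<in> universe U" using that D_subset by blast
      ultimately show ?thesis using ps qs foldr_limit that by (simp add: word_def)
    qed
    have "foldr limit ps x = foldr limit qs x" if x: "x \<in> universe U" for x
    proof -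
      obtain m where m: "n \<le> m" "x \<in> universe (D m)"
        using finite_subset_D[of "{x}" n] x by auto
      then have "set ps \<subseteq> PP L (C m)" "set qs \<subseteq> PP L (C m)" using ps qs PP_chain by blast+
      then show ?thesis using foldr_limit[of _ m x] word_action[OF m(1) ps(1) qs(1) agree] m by simp
    qed
    then show "v = w" unfolding ps qs word_def by auto
  qed
  show "?r ` words n \<subseteq> universe (D n) \<rightarrow>\<^sub>E universe (D n)"
  proof
    fix f assume "f \<in> ?r ` words n"
    then obtain ps where "set ps \<subseteq> PP L (C n)" "f = ?r (word ps)" by (auto simp: words_def)
    then show "f \<in> universe (D n) \<rightarrow>\<^sub>E universe (D n)"
      using foldr_limit[of ps n] D_subset[of n] by (auto simp: word_def subset_iff)
  qed
  show "finite (universe (D n) \<rightarrow>\<^sub>E universe (D n))" by (intro finite_PiE finite_D)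
qed

lemma subgroup_words: "subgroup (words n) (Aut L U)"
proof (rule group.finite_submonoid_subgroup[OF group_Aut finite_words])
  show "words n \<subseteq> carrier (Aut L U)" using word_Aut by (auto simp: words_def)
  show "\<one>\<^bsub>Aut L U\<^esub> \<in> words n" unfolding words_def word_Nil[symmetric] by auto
  fix v w assume "v \<in> words n" "w \<in> words n"
  then obtain ps qs where "set ps \<subseteq> PP L (C n)" "v = word ps" "set qs \<subseteq> PP L (C n)" "w = word qs"
    by (auto simp: words_def)
  then show "v \<otimes>\<^bsub>Aut L U\<^esub> w \<in> words n"
    using word_append[of ps n qs] unfolding words_def by (intro image_eqI[where x = "ps @ qs"]) auto
qed

lemma words_mono: "m \<le> n \<Longrightarrow> words m \<subseteq> words n"
  unfolding words_def using PP_chain by blast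

section \<open>The union of the finite groups of words\<close>

definition all_words :: "('a \<Rightarrow> 'a) set" where
  "all_words = (\<Union>n. words n)"

lemma finite_subset_words:
  assumes "finite S" "S \<subseteq> all_words"
  shows "\<exists>n. S \<subseteq> words n"
  using assms
proof (induction S)
  case (insert x S)
  then obtain m n where "S \<subseteq> words n" "x \<in> words m" unfolding all_words_def by blast
  then have "insert x S \<subseteq> words (max m n)"
    using words_mono[of m "max m n"] words_mono[of n "max m n"] by auto
  then show ?case by blast
qed auto

lemma subgroup_all_words: "subgroup all_words (Aut L U)"
proof (rule group.subgroupI[OF group_Aut])
  show "all_words \<subseteq> carrier (Aut L U)"
    unfolding all_words_def using subgroup.subset[OF subgroup_words] by blast
  show "all_words \<noteq> {}"
    unfolding all_words_def using subgroup.one_closed[OF subgroup_words] by blast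
  show "inv\<^bsub>Aut L U\<^esub> a \<in> all_words" if "a \<in> all_words" for a
    using that subgroup.m_inv_closed[OF subgroup_words] unfolding all_words_def by blast
  show "a \<otimes>\<^bsub>Aut L U\<^esub> b \<in> all_words" if ab: "a \<in> all_words" "b \<in> all_words" for a b
  proof -
    obtain n where "{a, b} \<subseteq> words n" using finite_subset_words[of "{a, b}"] ab by auto
    then have "a \<otimes>\<^bsub>Aut L U\<^esub> b \<in> words n" using subgroup.m_closed[OF subgroup_words] by blast
    then show ?thesis by (auto simp: all_words_def)
  qed
qed

text \<open>The groups \<open>words n\<close> increase, so finitely many elements lie in one of
  them, and that finite group contains everything they generate.\<close>

lemma locally_finite_all_words: "locally_finite_group ((Aut L U)\<lparr>carrier := all_words\<rparr>)"
  unfolding locally_finite_group_def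
proof (intro conjI allI impI)
  show "group ((Aut L U)\<lparr>carrier := all_words\<rparr>)"
    by (rule subgroup.subgroup_is_group[OF subgroup_all_words group_Aut])
  fix S assume "S \<subseteq> carrier ((Aut L U)\<lparr>carrier := all_words\<rparr>) \<and> finite S"
  then have S: "S \<subseteq> all_words" "finite S" by auto
  then obtain n where n: "S \<subseteq> words n" using finite_subset_words by blast
  \<comment> \<open>Generation inside the subgroup agrees with generation in \<open>Aut L U\<close>,
    where \<open>words n\<close> is known to be a subgroup.\<close>
  have "generate ((Aut L U)\<lparr>carrier := all_words\<rparr>) S = generate (Aut L U) S"
    using S group.generate_consistent[OF group_Aut _ subgroup_all_words] by simp
  also have "\<dots> \<subseteq> words n"
    by (rule group.generate_subgroup_incl[OF group_Aut n subgroup_words])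
  finally show "finite (generate ((Aut L U)\<lparr>carrier := all_words\<rparr>) S)"
    using finite_words finite_subset by blast
qed

text \<open>If \<open>g\<close> moves a point of \<open>F\<close>, its graph on \<open>F\<close> is
  a letter and the word of length one suffices. As \<open>PP\<close> excludes restrictions of the
  identity, the remaining case is served by the empty word.\<close>

lemma all_words_approx:
  assumes g: "g \<in> carrier (Aut L U)" and F: "finite F" "F \<subseteq> universe U"
  shows "\<exists>w\<in>all_words. \<forall>x\<in>F. w x = g x"
proof (cases "\<forall>x\<in>F. g x = x")
  case True
  have "word [] \<in> all_words"
    unfolding word_Nil using subgroup.one_closed[OF subgroup_all_words] .
  moreover have "\<forall>x\<in>F. word [] x = g x" using True F by (auto simp: word_def)
  ultimately show ?thesis by blast
next
  case False
  then obtain y where y: "y \<in> F" "g y \<noteq> y" by blast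
  \<comment> \<open>The stage must contain the images as well, so that the graph of \<open>g\<close>
    on \<open>F\<close> is a partial isomorphism of \<open>C n\<close>.\<close>
  have "F \<union> g ` F \<subseteq> universe U" using F Aut_closed[OF g] by auto
  then obtain n where n: "F \<union> g ` F \<subseteq> universe (C n)"
    using finite_subset_C[of "F \<union> g ` F" 0] F by auto
  define p where "p = (\<lambda>x. (x, g x)) ` F"
  have p: "p \<in> PP L (C n)"
    unfolding p_def
    by (rule Aut_restriction_PP[OF is_structure g C_substructure F(1) _ _ y]) (use n in auto)
  have "word [p] x = g x" if "x \<in> F" for x
  proof -
    have "x \<in> universe (D n)" "x \<in> universe U" using n that F C_subset_D by auto
    moreover have "(x, g x) \<in> p" using that by (auto simp: p_def)
    then have "\<phi> n p x = g x" using HL[of n] p by (auto simp: HL_extension_def)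
    ultimately show ?thesis using limit_eq p by (simp add: word_def)
  qed
  moreover have "word [p] \<in> words n" unfolding words_def using p by (intro imageI) simp
  then have "word [p] \<in> all_words" by (auto simp: all_words_def)
  ultimately show ?thesis by blast
qed

end


section \<open>Density\<close>

lemma topspace_Aut_topology: "topspace (Aut_topology L U) = carrier (Aut L U)"
proof -
  have "carrier (Aut L U) \<subseteq> universe U \<rightarrow>\<^sub>E universe U"
  proof
    fix f assume f: "f \<in> carrier (Aut L U)"
    show "f \<in> universe U \<rightarrow>\<^sub>E universe U"
      unfolding PiE_def using Aut_extensional[OF f] Aut_closed[OF f] by blast
  qed
  then show ?thesis by (auto simp: Aut_topology_def)
qed

text \<open>A basic open set of the product constrains finitely many coordinates, so a neighbourhood
  of \<open>g\<close> contains every automorphism agreeing with \<open>g\<close> on some finite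
  set.\<close>

lemma Aut_topology_dense:
  assumes H: "H \<subseteq> carrier (Aut L U)"
    and approx: "\<And>g F. \<lbrakk>g \<in> carrier (Aut L U); finite F; F \<subseteq> universe U\<rbrakk>
      \<Longrightarrow> \<exists>h\<in>H. \<forall>x\<in>F. h x = g x"
  shows "(Aut_topology L U) closure_of H = topspace (Aut_topology L U)"
proof
  show "(Aut_topology L U) closure_of H \<subseteq> topspace (Aut_topology L U)"
    by (rule closure_of_subset_topspace)
  show "topspace (Aut_topology L U) \<subseteq> (Aut_topology L U) closure_of H"
  proof
    fix g assume "g \<in> topspace (Aut_topology L U)"
    then have g: "g \<in> carrier (Aut L U)" by (simp add: topspace_Aut_topology)
    have "\<exists>h\<in>H. h \<in> T" if T: "g \<in> T" "openin (Aut_topology L U) T" for T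
    proof -
      obtain V where V: "openin (product_topology (\<lambda>_. discrete_topology (universe U)) (universe U)) V"
        "T = V \<inter> carrier (Aut L U)"
        using T(2) by (auto simp: Aut_topology_def openin_subtopology)
      then have "g \<in> V" using T by blast
      then obtain W where W: "finite {i \<in> universe U. W i \<noteq> universe U}"
        "g \<in> Pi\<^sub>E (universe U) W" "Pi\<^sub>E (universe U) W \<subseteq> V"
        using V(1) unfolding openin_product_topology_alt topspace_discrete_topology by blast
      obtain h where h: "h \<in> H" "\<forall>x\<in>{i \<in> universe U. W i \<noteq> universe U}. h x = g x"
        using approx[OF g W(1)] by auto
      have hA: "h \<in> carrier (Aut L U)" using h H by blast
      \<comment> \<open>Where \<open>W x\<close> is all of \<open>U\<close> it is enough that
        \<open>h\<close> maps \<open>U\<close> to itself; at the finitely many other coordinates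
        \<open>h x\<close> equals \<open>g x\<close>.\<close>
      have "h x \<in> W x" if "x \<in> universe U" for x
        using that h(2) W(2) Aut_closed[OF hA that] by (cases "W x = universe U") (auto simp: PiE_def)
      then have "h \<in> Pi\<^sub>E (universe U) W" using Aut_extensional[OF hA] by (auto simp: PiE_def)
      then show ?thesis using W V hA h by blast
    qed
    then show "g \<in> (Aut_topology L U) closure_of H"
      using g by (auto simp: in_closure_of topspace_Aut_topology)
  qed
qed

section \<open>Existence of a coherent chain\<close>

lemma minimal_HL_extension_empty:
  assumes "is_structure L U"
  shows "minimal_HL_extension L (induced U {}) (induced U {}) \<phi>"
proof -
  have "substructure L (induced U {}) (induced U {})"
    using substructure_within substructure_induced[OF assms] by blast
  \<comment> \<open>The only partial isomorphism of the empty structure is the empty map, which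
    restricts the identity. All conditions on \<open>\<phi>\<close> are thus vacuous.\<close>
  moreover have "PP L (induced U {}) = {}"
    by (auto simp: PP_def partial_isos_def substructure_def)
  ultimately show ?thesis
    by (simp add: minimal_HL_extension_def HL_extension_def)
qed

lemma coherent_chain_exists:
  fixes U :: "('a, 'r) rel_structure"
  assumes U: "is_structure L U" "countable (universe U)" "ultraextensive L U"
  shows "\<exists>C D \<phi>. coherent_chain L U C D \<phi>"
proof -
  \<comment> \<open>The fibres of an enumeration have at most one point each, and some may be empty;
    this treats finite and infinite \<open>U\<close> alike.\<close>
  define E where "E n = {x \<in> universe U. to_nat_on (universe U) x = n}" for n
  have finE: "finite (E n)" for n
  proof (rule inj_on_finite)
    show "inj_on (to_nat_on (universe U)) (E n)"
      using inj_on_to_nat_on[OF U(2)] by (rule inj_on_subset) (auto simp: E_def)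
    show "to_nat_on (universe U) ` E n \<subseteq> {n}" by (auto simp: E_def)
  qed simp
  \<comment> \<open>Minimality is part of the invariant because clause (iii) of ultraextensivity
    accepts only a minimal extension as its starting point.\<close>
  let ?P = "\<lambda>(C, D, \<phi>). substructure L D U \<and> finite_structure D \<and> minimal_HL_extension L C D \<phi>"
  let ?Q = "\<lambda>n (C, D, \<phi>) (C', D', \<phi>'). coherent L C D \<phi> C' D' \<phi>' \<and> E n \<subseteq> universe C'"
  have "\<exists>f. \<forall>n. ?P (f n) \<and> ?Q n (f n) (f (Suc n))"
  proof (rule dependent_nat_choice)
    have "?P (induced U {}, induced U {}, \<lambda>_. id)"
      using minimal_HL_extension_empty[OF U(1)] substructure_induced[OF U(1)]
      by (simp add: finite_structure_def)
    then show "\<exists>s. ?P s" by blast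
  next
    fix s n assume "?P s"
    then obtain C D \<phi> where s: "s = (C, D, \<phi>)" and D: "substructure L D U" "finite_structure D"
      and min: "minimal_HL_extension L C D \<phi>"
      by (cases s) auto
    have CD: "substructure L C D"
      using min by (simp add: minimal_HL_extension_def HL_extension_def)
    \<comment> \<open>The next structure absorbs the previous extension, which gives the nesting of
      the chain, and the next point of the enumeration, which gives exhaustion.\<close>
    define C' where "C' = induced U (universe D \<union> E n)"
    have DU: "universe D \<subseteq> universe U" using D by (simp add: substructure_def)
    have C': "substructure L C' U"
      unfolding C'_def using DU by (intro substructure_induced U) (auto simp: E_def)
    have "substructure L C C'"
    proof (rule substructure_within[OF _ C'])
      show "substructure L C U" using CD D(1) by (rule substructure_trans)
      show "universe C \<subseteq> universe C'" using CD by (auto simp: substructure_def C'_def)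
    qed
    moreover have "finite_structure C" "finite_structure C'"
      using D(2) CD finE[of n] finite_subset[of "universe C" "universe D"]
      by (auto simp: finite_structure_def C'_def substructure_def)
    ultimately have "\<exists>D' \<phi>'. substructure L D' U \<and> finite_structure D' \<and>
        minimal_HL_extension L C' D' \<phi>' \<and> coherent L C D \<phi> C' D' \<phi>'"
      using U(3) C' D min unfolding ultraextensive_def by blast
    then obtain D' \<phi>' where "?P (C', D', \<phi>')" "coherent L C D \<phi> C' D' \<phi>'" by auto
    moreover have "E n \<subseteq> universe C'" by (simp add: C'_def)
    ultimately show "\<exists>s'. ?P s' \<and> ?Q n s s'" unfolding s by blast
  qed
  then obtain f where "\<forall>n. ?P (f n) \<and> ?Q n (f n) (f (Suc n))" ..
  then have f: "?P (f n)" "?Q n (f n) (f (Suc n))" for n by simp_all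
  define C D \<phi> where "C n = fst (f n)" "D n = fst (snd (f n))" "\<phi> n = snd (snd (f n))" for n
  have "f n = (C n, D n, \<phi> n)" for n by (simp add: C_D_\<phi>_def)
  then have *: "substructure L (D n) U" "finite_structure (D n)"
    "coherent L (C n) (D n) (\<phi> n) (C (Suc n)) (D (Suc n)) (\<phi> (Suc n))"
    "E n \<subseteq> universe (C (Suc n))" for n
    using f(1)[of n] f(2)[of n] by auto
  have "universe U \<subseteq> (\<Union>n. universe (C n))"
  proof
    fix x assume "x \<in> universe U"
    \<comment> \<open>The fibre numbered \<open>n\<close> enters at stage \<open>Suc n\<close>, so
      every point is reached one stage after its number.\<close>
    then have "x \<in> E (to_nat_on (universe U) x)" by (simp add: E_def)
    then show "x \<in> (\<Union>n. universe (C n))" using *(4) by blast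
  qed
  then have "coherent_chain L U C D \<phi>"
    using * U(1) by unfold_locales (auto simp: finite_structure_def)
  then show ?thesis by blast
qed

theorem theorem1p6:
  fixes L :: "'r language" and U :: "('a, 'r) rel_structure"
  assumes "finite (symbols L)"
    and "is_structure L U"
    and "countable (universe U)"
    and "ultraextensive L U"
  shows "\<exists>H. subgroup H (Aut L U) \<and>
             locally_finite_group ((Aut L U)\<lparr>carrier := H\<rparr>) \<and>
             (Aut_topology L U) closure_of H = topspace (Aut_topology L U)"
proof -
  obtain C D \<phi> where "coherent_chain L U C D \<phi>"
    using coherent_chain_exists assms by blast
  then interpret coherent_chain L U C D \<phi> .
  have "(Aut_topology L U) closure_of all_words = topspace (Aut_topology L U)"
    by (rule Aut_topology_dense[OF subgroup.subset[OF subgroup_all_words] all_words_approx])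
  then show ?thesis using subgroup_all_words locally_finite_all_words by blast
qed

end
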